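(* Let $p$ be a prime, $R\ge1$, $V=\mathbb{F}_{p^R}$, and let $k\ge2$ divide $p^R-1$ with $\frac{p^R-1}{k}$ even if $p$ is odd. Let $\Gamma=\mathrm{GPaley}(p^R,\frac{p^R-1}{k})=\mathrm{Cay}(V,S)$ be a connected generalised Paley graph. Then for a divisor $a$ of $R$ with $1\le a<R$, $\Gamma$ is isomorphic to the Hamming graph $H(p^a,\frac{R}{a})$ if and only if $k=\frac{a(p^R-1)}{R(p^a-1)}$.
   Context: For $V=\mathbb{F}_q$ ($q=p^R$), $k\ge2$ with $k\mid q-1$ and $\frac{q-1}{k}$ even if $p$ is odd, and a fixed primitive element $\omega$ of $\mathbb{F}_q$, the generalised Paley graph $\mathrm{GPaley}(q,\frac{q-1}{k})$ is the Cayley graph $\mathrm{Cay}(V,S)$ with $S=\{\omega^{jk}: j\ge0\}$: vertex set $V$, and $\{u,v\}$ is an edge iff $v-u\in S$. The Hamming graph $H(a,b)$ ($b>1$) has as vertices the $b$-tuples with entries from a set of size $a$, two vertices being adjacent iff they differ in exactly one coordinate. *)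

theory Defs
  imports
    Complex_Main
    "HOL-Library.Cardinality"
    "HOL-Computational_Algebra.Primes"
    "Graph_Theory.Graph_Theory"
begin

text \<open>
  Undirected simple graphs are represented, as in the library, by symmetric loop-free
  digraphs without parallel arcs: the edge \<open>{u, v}\<close> corresponds to the two
  arcs \<open>(u, v)\<close> and \<open>(v, u)\<close>. That the graphs below are of this kind is
  proved in \<open>pair_graph_gpaley\<close> and \<open>pair_graph_hamming\<close>.
\<close>

definition primitive_element :: "'v::field \<Rightarrow> bool" where
  "primitive_element \<omega> \<longleftrightarrow> range (\<lambda>n::nat. \<omega> ^ n) = UNIV - {0}"

definition cayley_graph :: "'v::ab_group_add set \<Rightarrow> 'v pair_pre_digraph" where
  "cayley_graph S = \<lparr> pverts = UNIV, parcs = {(u, v). v - u \<in> S} \<rparr>"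

text \<open>
  \<open>gpaley \<omega> k\<close> is \<open>GPaley(q, (q-1)/k)\<close>, where \<open>q\<close> is the order of the
  field \<open>'v\<close> and \<open>\<omega>\<close> is the chosen primitive element.
\<close>

definition gpaley :: "'v::field \<Rightarrow> nat \<Rightarrow> 'v pair_pre_digraph" where
  "gpaley \<omega> k = cayley_graph {\<omega> ^ (j * k) | j::nat. True}"

definition hamming_verts :: "nat \<Rightarrow> nat \<Rightarrow> nat list set" where
  "hamming_verts a b = {xs. length xs = b \<and> set xs \<subseteq> {..<a}}"

definition hamming_graph :: "nat \<Rightarrow> nat \<Rightarrow> nat list pair_pre_digraph" where
  "hamming_graph a b =
    \<lparr> pverts = hamming_verts a b,
      parcs = {(xs, ys). xs \<in> hamming_verts a b \<and> ys \<in> hamming_verts a b \<and>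
                 (\<exists>!i. i < b \<and> xs ! i \<noteq> ys ! i)} \<rparr>"

lemma primitive_element_power_eq_1_iff:
  fixes \<omega> :: "'v::{field,finite}"
  assumes "primitive_element \<omega>"
  shows "\<omega> ^ d = 1 \<longleftrightarrow> CARD('v) - 1 dvd d"
proof -
  let ?q = "CARD('v) - 1"
  have rng: "range (\<lambda>n::nat. \<omega> ^ n) = UNIV - {0}"
    using assms by (simp add: primitive_element_def)
  have nz: "\<omega> \<noteq> 0"
    using rng by (metis DiffD2 power_one_right rangeI singletonI)
  have card: "card (UNIV - {0::'v}) = ?q"
    by (simp add: card_Diff_singleton)
  have bij: "bij_betw (\<lambda>x. \<omega> * x) (UNIV - {0}) (UNIV - {0})"
    by (rule bij_betwI[where g = "\<lambda>x. x / \<omega>"]) (use nz in auto)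
  have "(\<Prod>x\<in>UNIV - {0}. x) = (\<Prod>x\<in>UNIV - {0}. \<omega> * x)"
    using prod.reindex_bij_betw[OF bij, of "\<lambda>x. x"] by simp
  also have "\<dots> = \<omega> ^ ?q * (\<Prod>x\<in>UNIV - {0}. x)"
    by (simp add: prod.distrib card)
  finally have pow: "\<omega> ^ ?q = 1"
    by simp
  have mod: "\<omega> ^ n = \<omega> ^ (n mod e)" if "\<omega> ^ e = 1" for n e
    by (metis div_mult_mod_eq mult.commute mult_1 power_add power_mult power_one that)
  have min: "?q \<le> e" if "\<omega> ^ e = 1" "e > 0" for e
  proof -
    have "UNIV - {0} \<subseteq> (\<lambda>n. \<omega> ^ n) ` {..<e}"
      using that(2) mod[OF that(1)] mod_less_divisor unfolding rng[symmetric] image_def by blast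
    then have "card (UNIV - {0::'v}) \<le> card {..<e}"
      by (meson surj_card_le finite_lessThan)
    then show ?thesis using card by simp
  qed
  show ?thesis
  proof
    assume d: "\<omega> ^ d = 1"
    have "\<omega> ^ (d mod ?q) = 1"
      using d mod[OF pow, of d] by simp
    moreover have "?q > 0"
      unfolding card[symmetric] card_gt_0_iff using nz by auto
    ultimately have "d mod ?q = 0"
      using min[of "d mod ?q"] mod_less_divisor[of ?q d] by linarith
    then show "?q dvd d" by auto
  next
    assume "?q dvd d"
    then show "\<omega> ^ d = 1"
      using pow by (auto simp: power_mult)
  qed
qed

lemma pair_graph_gpaley:
  fixes \<omega> :: "'v::{field,finite}"
  assumes "primitive_element \<omega>" and card: "CARD('v) = p ^ R" and "prime p" and "R \<ge> 1"
    and k: "k dvd p ^ R - 1" and ev: "odd p \<longrightarrow> even ((p ^ R - 1) div k)"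
  shows "pair_graph (gpaley \<omega> k)"
proof -
  have rng: "range (\<lambda>n::nat. \<omega> ^ n) = UNIV - {0}"
    using assms(1) by (simp add: primitive_element_def)
  have nz: "\<omega> \<noteq> 0"
    using rng by (metis DiffD2 power_one_right rangeI singletonI)
  obtain n where n: "- 1 = \<omega> ^ n"
    using rng by (metis DiffI UNIV_I imageE neg_equal_0_iff_equal singletonD zero_neq_one)
  have "\<omega> ^ (2 * n) = 1"
    by (metis mult.commute n power2_minus power_mult power_one)
  then have dvd: "p ^ R - 1 dvd 2 * n"
    using primitive_element_power_eq_1_iff[OF assms(1)] card by simp
  have "k dvd n"
  proof (cases "odd p")
    case True
    then obtain l where "p ^ R - 1 = k * (2 * l)"
      using ev k by (metis dvd_def dvd_mult_div_cancel)
    then have "2 * (k * l) dvd 2 * n"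
      using dvd by (simp add: mult.left_commute)
    then show ?thesis
      by (metis dvd_mult_left nat_mult_dvd_cancel_disj zero_neq_numeral)
  next
    case False
    then have "even (p ^ R)"
      using assms(4) by simp
    moreover have "p ^ R > 0"
      using card by (metis finite_UNIV_card_ge_0 finite)
    ultimately have "coprime (p ^ R - 1) 2"
      by simp
    then show ?thesis
      using dvd k by (metis coprime_dvd_mult_right_iff dvd_trans)
  qed
  then obtain m where m: "n = m * k"
    by (metis dvd_div_mult_self)
  have sym: "u - v \<in> {\<omega> ^ (j * k) | j. True}" if vu: "v - u \<in> {\<omega> ^ (j * k) | j. True}" for u v
  proof -
    obtain j where j: "v - u = \<omega> ^ (j * k)"
      using vu by blast
    have "u - v = (- 1) * (v - u)"
      by simp
    also have "\<dots> = \<omega> ^ ((m + j) * k)"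
      unfolding j n m by (simp add: power_add algebra_simps)
    finally show ?thesis by blast
  qed
  show ?thesis
    by unfold_locales (use sym nz in \<open>auto simp: gpaley_def cayley_graph_def symmetric_def intro!: symI\<close>)
qed

lemma pair_graph_hamming: "pair_graph (hamming_graph a b)"
proof -
  have fin: "finite (hamming_verts a b)"
    using finite_lists_length_eq[of "{..<a}" b] by (simp add: hamming_verts_def conj_commute)
  have "parcs (hamming_graph a b) \<subseteq> hamming_verts a b \<times> hamming_verts a b"
    by (auto simp: hamming_graph_def)
  then have "finite (parcs (hamming_graph a b))"
    using fin by (meson finite_SigmaI finite_subset)
  moreover have "sym (parcs (hamming_graph a b))"
  proof (rule symI)
    fix xs ys :: "nat list"
    have "(\<lambda>i. i < b \<and> xs ! i \<noteq> ys ! i) = (\<lambda>i. i < b \<and> ys ! i \<noteq> xs ! i)"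
      by fastforce
    then show "(ys, xs) \<in> parcs (hamming_graph a b)" if "(xs, ys) \<in> parcs (hamming_graph a b)"
      using that by (simp add: hamming_graph_def)
  qed
  moreover have "fst e \<in> hamming_verts a b \<and> snd e \<in> hamming_verts a b \<and> fst e \<noteq> snd e"
    if "e \<in> parcs (hamming_graph a b)" for e
    using that by (cases e) (simp add: hamming_graph_def, blast)
  moreover have "pverts (hamming_graph a b) = hamming_verts a b"
    by (simp add: hamming_graph_def)
  ultimately show ?thesis
    using fin by unfold_locales (simp_all add: symmetric_def)
qed

end

theory Submission
  imports "HOL-Number_Theory.Residues" Defs
begin

text \<open>
  Put \<open>b = R / a\<close>. The two graphs are regular of degrees \<open>(p^R - 1) / k\<close> and \<open>b (p^a - 1)\<close>, so an
  isomorphism forces the value of \<open>k\<close>. Conversely, for this \<open>k\<close> the connection set \<open>S\<close> is the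
  subgroup of order \<open>b (p^a - 1)\<close> of the multiplicative group, hence a union of \<open>b\<close> cosets
  \<open>c\<^sub>i K\<^sup>*\<close> of the multiplicative group of the subfield \<open>K\<close> of order \<open>p^a\<close>. Connectedness says that
  \<open>S\<close> spans the field additively, so the \<open>c\<^sub>i\<close> form a basis over \<open>K\<close>, and two elements are adjacent
  iff their coordinates differ in exactly one place.
\<close>

section \<open>Powers of a primitive element\<close>

lemma primitive_element_nonzero:
  assumes "primitive_element \<omega>"
  shows "\<omega> \<noteq> 0"
  using assms unfolding primitive_element_def
  by (metis DiffD2 power_one_right rangeI singletonI)

lemma primitive_element_power_eq_iff:
  fixes \<omega> :: "'v::{field,finite}"
  assumes "primitive_element \<omega>"
  shows "\<omega> ^ i = \<omega> ^ j \<longleftrightarrow> [i = j] (mod (CARD('v) - 1))"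
proof -
  have *: "\<omega> ^ i = \<omega> ^ j \<longleftrightarrow> [i = j] (mod (CARD('v) - 1))" if "i \<le> j" for i j
  proof -
    have "\<omega> ^ j = \<omega> ^ i * \<omega> ^ (j - i)"
      using that by (simp flip: power_add)
    then have "\<omega> ^ i = \<omega> ^ j \<longleftrightarrow> \<omega> ^ (j - i) = 1"
      using primitive_element_nonzero[OF assms] by auto
    also have "\<dots> \<longleftrightarrow> [i = j] (mod (CARD('v) - 1))"
      using primitive_element_power_eq_1_iff[OF assms] that
      by (metis cong_altdef_nat cong_sym_eq)
    finally show ?thesis .
  qed
  show ?thesis
    using *[of i j] *[of j i] by (metis cong_sym_eq nat_le_linear)
qed

text \<open>Exponents count modulo \<open>n * k\<close>, so \<open>\<omega> ^ (j * k)\<close>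
  depends only on \<open>j mod n\<close>. This yields both the order of the connection set and that
  of the multiplicative group of the subfield.\<close>

lemma bij_betw_power_subgroup:
  fixes \<omega> :: "'v::{field,finite}"
  assumes \<omega>: "primitive_element \<omega>" and "n * k = CARD('v) - 1" and "n > 0" and "k > 0"
  shows "bij_betw (\<lambda>j. \<omega> ^ (j * k)) {..<n} {\<omega> ^ (j * k) | j. True}"
proof -
  have eq: "\<omega> ^ (i * k) = \<omega> ^ (j * k) \<longleftrightarrow> i mod n = j mod n" for i j
    using assms(4) unfolding primitive_element_power_eq_iff[OF \<omega>] assms(2)[symmetric]
    unfolding cong_def mult_mod_left[symmetric] by simp
  have "inj_on (\<lambda>j. \<omega> ^ (j * k)) {..<n}"
    by (rule inj_onI) (simp add: eq)
  moreover have "\<omega> ^ (j * k) \<in> (\<lambda>j. \<omega> ^ (j * k)) ` {..<n}" for j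
    using eq[of j "j mod n"] assms(3) by (intro image_eqI[of _ _ "j mod n"]) auto
  ultimately show ?thesis
    by (auto simp: bij_betw_def)
qed

section \<open>The subfield as fixed points of a Frobenius power\<close>

lemma CHAR_eq_prime_of_CARD:
  assumes "prime p" and "CARD('v::{field,finite}) = p ^ R"
  shows "CHAR('v) = p"
proof -
  have "prime CHAR('v)"
    by (intro prime_CHAR_semidom finite_imp_CHAR_pos) auto
  moreover have "CHAR('v) dvd p ^ R"
    using CHAR_dvd_CARD[where 'a = 'v] assms(2) by simp
  ultimately show ?thesis
    using assms(1) by (metis prime_dvd_power primes_dvd_imp_eq)
qed

lemma frobenius_fixed_diff:
  fixes x y :: "'v::{field,finite}"
  assumes "prime p" and "CHAR('v) = p" and "x ^ p ^ a = x" and "y ^ p ^ a = y"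
  shows "(x - y) ^ p ^ a = x - y"
proof -
  \<comment> \<open>Additivity is applied to \<open>(x - y) + y\<close>, which avoids the sign
    \<open>(- 1) ^ p ^ a\<close>.\<close>
  have "((x - y) + y) ^ p ^ a = (x - y) ^ p ^ a + y ^ p ^ a"
    using assms(1,2) by (intro freshmans_dream') auto
  then show ?thesis
    using assms(3,4) by (simp add: algebra_simps)
qed

text \<open>For \<open>x = \<omega> ^ i\<close> the equation amounts to
  \<open>x ^ (n - 1) = 1\<close>, hence to \<open>(n - 1) * d dvd i * (n - 1)\<close>, hence to
  \<open>d dvd i\<close>. With \<open>n = p ^ a\<close> the nonzero solutions form the
  multiplicative group of the subfield.\<close>

lemma frobenius_fixed_eq:
  fixes \<omega> :: "'v::{field,finite}"
  assumes \<omega>: "primitive_element \<omega>" and nd: "(n - 1) * d = CARD('v) - 1" and "n > 1"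
  shows "{x::'v. x ^ n = x} = insert 0 {\<omega> ^ (j * d) | j. True}"
proof (rule Set.set_eqI)
  fix x :: 'v
  show "x \<in> {x. x ^ n = x} \<longleftrightarrow> x \<in> insert 0 {\<omega> ^ (j * d) | j. True}"
  proof (cases "x = 0")
    case False
    then obtain i where i: "x = \<omega> ^ i"
      using \<omega> unfolding primitive_element_def by (metis DiffI UNIV_I imageE singletonD)
    have "x ^ n = x \<longleftrightarrow> x ^ (n - 1) = 1"
      using False assms(3) by (metis One_nat_def Suc_pred less_trans mult_cancel_left2
          mult.commute power_Suc zero_less_one)
    also have "\<dots> \<longleftrightarrow> (n - 1) * d dvd i * (n - 1)"
      unfolding i nd power_mult[symmetric] primitive_element_power_eq_1_iff[OF \<omega>] ..
    also have "\<dots> \<longleftrightarrow> d dvd i"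
      using assms(3) by (metis One_nat_def diff_is_0_eq mult.commute nat_mult_dvd_cancel_disj
          not_less)
    also have "\<dots> \<longleftrightarrow> x \<in> {\<omega> ^ (j * d) | j. True}"
    proof
      assume "d dvd i" then show "x \<in> {\<omega> ^ (j * d) | j. True}"
        unfolding i by (auto simp: dvd_def mult.commute)
    next
      assume "x \<in> {\<omega> ^ (j * d) | j. True}"
      \<comment> \<open>The exponent of \<open>x\<close> is not unique, but two exponents agree
        modulo \<open>(n - 1) * d\<close>, hence modulo \<open>d\<close>.\<close>
      then obtain j where "[i = j * d] (mod (n - 1) * d)"
        unfolding i using primitive_element_power_eq_iff[OF \<omega>] nd by auto
      then have "[i = j * d] (mod d)"
        by (rule cong_dvd_modulus_nat) simp
      then show "d dvd i"
        using cong_dvd_iff by fastforce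
    qed
    finally show ?thesis using False by simp
  qed (use assms(3) in auto)
qed

lemma card_frobenius_fixed:
  fixes \<omega> :: "'v::{field,finite}"
  assumes \<omega>: "primitive_element \<omega>" and nd: "(n - 1) * d = CARD('v) - 1" and "n > 1"
  shows "card {x::'v. x ^ n = x} = n"
proof -
  \<comment> \<open>This excludes \<open>d = 0\<close> in \<open>nd\<close>.\<close>
  have "CARD('v) > 1"
    using card_mono[of "UNIV :: 'v set" "{0, 1}"] by simp
  then have "d > 0" using nd by (cases d) auto
  then have "card {\<omega> ^ (j * d) | j. True} = n - 1"
    using bij_betw_same_card[OF bij_betw_power_subgroup[OF \<omega> nd]] assms(3) by simp
  moreover have "0 \<notin> {\<omega> ^ (j * d) | j. True}"
    using primitive_element_nonzero[OF \<omega>] by auto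
  ultimately show ?thesis
    unfolding frobenius_fixed_eq[OF assms] using assms(3) by simp
qed

section \<open>Degrees of Cayley graphs and Hamming graphs\<close>

lemma out_degree_cayley_graph:
  "out_degree (with_proj (cayley_graph S)) u = card S"
proof -
  have "bij_betw (\<lambda>s. (u, u + s)) S (out_arcs (with_proj (cayley_graph S)) u)"
    by (rule bij_betwI[where g = "\<lambda>e. snd e - fst e"]) (auto simp: cayley_graph_def)
  then show ?thesis
    unfolding out_degree_def by (metis bij_betw_same_card)
qed

text \<open>List updates parametrise the neighbours by a position and a new entry. This form serves
  the degree count and, later, the effect of a move on a sum over coordinates.\<close>

lemma hamming_adjacent_iff:
  assumes "xs \<in> hamming_verts a b"
  shows "(xs, ys) \<in> parcs (hamming_graph a b) \<longleftrightarrow>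
    (\<exists>i x. i < b \<and> x < a \<and> x \<noteq> xs ! i \<and> ys = xs[i := x])"
proof
  assume "(xs, ys) \<in> parcs (hamming_graph a b)"
  then have ex1: "\<exists>!i. i < b \<and> xs ! i \<noteq> ys ! i" and ys: "length ys = b" "set ys \<subseteq> {..<a}"
    by (simp_all add: hamming_graph_def hamming_verts_def)
  from ex1 obtain i where i: "i < b" "xs ! i \<noteq> ys ! i"
    and eq: "\<And>j. j < b \<Longrightarrow> j \<noteq> i \<Longrightarrow> xs ! j = ys ! j"
    by blast
  have "ys = xs[i := ys ! i]"
    using assms eq i(1) ys by (intro nth_equalityI) (simp_all add: hamming_verts_def nth_list_update)
  moreover have "ys ! i < a"
    using i(1) ys by (metis lessThan_iff nth_mem subsetD)
  ultimately show "\<exists>i x. i < b \<and> x < a \<and> x \<noteq> xs ! i \<and> ys = xs[i := x]"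
    using i by metis
next
  assume "\<exists>i x. i < b \<and> x < a \<and> x \<noteq> xs ! i \<and> ys = xs[i := x]"
  then obtain i x where "i < b" "x < a" "x \<noteq> xs ! i" "ys = xs[i := x]" by blast
  then show "(xs, ys) \<in> parcs (hamming_graph a b)"
    using assms set_update_subset_insert[of xs i x] unfolding hamming_graph_def
    by (auto simp: hamming_verts_def nth_list_update intro!: ex1I[of _ i] split: if_splits)
qed

lemma out_degree_hamming_graph:
  assumes "xs \<in> hamming_verts a b"
  shows "out_degree (with_proj (hamming_graph a b)) xs = b * (a - 1)"
proof -
  let ?A = "SIGMA i:{..<b}. {..<a} - {xs ! i}"
  have len: "length xs = b"
    using assms by (simp add: hamming_verts_def)
  have lt: "xs ! i < a" if "i < b" for i
    using assms that nth_mem[of i xs] by (auto simp: hamming_verts_def simp del: nth_mem)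
  \<comment> \<open>A proper update reveals its position and its new entry, so distinct pairs give
    distinct neighbours.\<close>
  have update_eqD: "i = j \<and> x = y"
    if "i < b" "j < b" "x \<noteq> xs ! i" "y \<noteq> xs ! j" "xs[i := x] = xs[j := y]" for i j x y
    using that len by (metis nth_list_update_eq nth_list_update_neq)
  have "inj_on (\<lambda>(i, x). (xs, xs[i := x])) ?A"
    by (rule inj_onI) (auto dest: update_eqD)
  moreover have "(\<lambda>(i, x). (xs, xs[i := x])) ` ?A = out_arcs (with_proj (hamming_graph a b)) xs"
  proof (intro equalityI subsetI)
    fix e assume "e \<in> out_arcs (with_proj (hamming_graph a b)) xs"
    then obtain ys where "e = (xs, ys)" "(xs, ys) \<in> parcs (hamming_graph a b)"
      by (cases e) auto
    then obtain i x where "i < b" "x < a" "x \<noteq> xs ! i" "e = (xs, xs[i := x])"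
      using hamming_adjacent_iff[OF assms] by blast
    then show "e \<in> (\<lambda>(i, x). (xs, xs[i := x])) ` ?A"
      by (intro image_eqI[of _ _ "(i, x)"]) auto
  next
    fix e assume "e \<in> (\<lambda>(i, x). (xs, xs[i := x])) ` ?A"
    then obtain i x where "i < b" "x < a" "x \<noteq> xs ! i" and e: "e = (xs, xs[i := x])"
      by auto
    then have "(xs, xs[i := x]) \<in> parcs (hamming_graph a b)"
      using hamming_adjacent_iff[OF assms] by blast
    then show "e \<in> out_arcs (with_proj (hamming_graph a b)) xs"
      using e by simp
  qed
  ultimately have "out_degree (with_proj (hamming_graph a b)) xs = card ?A"
    unfolding out_degree_def by (metis card_image)
  also have "\<dots> = (\<Sum>i<b. card ({..<a} - {xs ! i}))"
    by (simp add: card_SigmaI)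
  also have "\<dots> = b * (a - 1)"
    using lt by simp
  finally show ?thesis .
qed

section \<open>Graph isomorphisms from coordinates\<close>

text \<open>The bijection \<open>h\<close> runs from \<open>H\<close> back to \<open>G\<close>
  because in the application this is the direction with an explicit formula, from coordinates to
  field elements.\<close>

lemma digraph_iso_with_projI:
  assumes "pair_graph G" and h: "bij_betw h (pverts H) (pverts G)"
    and H: "parcs H \<subseteq> pverts H \<times> pverts H"
    and arcs: "\<And>x y. x \<in> pverts H \<Longrightarrow> y \<in> pverts H \<Longrightarrow>
      (x, y) \<in> parcs H \<longleftrightarrow> (h x, h y) \<in> parcs G"
  shows "digraph_iso (with_proj G) (with_proj H)"
proof -
  interpret pair_graph G by fact
  define f where "f = the_inv_into (pverts H) h"
  have f: "bij_betw f (pverts G) (pverts H)"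
    using h unfolding f_def by (rule bij_betw_the_inv_into)
  have hf: "h (f u) = u" if "u \<in> pverts G" for u
    using that h unfolding f_def by (simp add: bij_betw_def f_the_inv_into_f)
  have fh: "f (h x) = x" if "x \<in> pverts H" for x
    using that h unfolding f_def by (simp add: bij_betw_def the_inv_into_f_f)
  have G: "u \<in> pverts G \<and> v \<in> pverts G" if "(u, v) \<in> parcs G" for u v
    using in_arcsD1 in_arcsD2 that by metis
  have img: "map_prod f f ` parcs G = parcs H"
  proof (intro equalityI subsetI)
    fix e assume "e \<in> map_prod f f ` parcs G"
    then obtain u v where uv: "(u, v) \<in> parcs G" "e = (f u, f v)" by auto
    then show "e \<in> parcs H"
      using G[OF uv(1)] arcs[of "f u" "f v"] f hf by (auto simp: bij_betw_def)
  next
    fix e assume e: "e \<in> parcs H"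
    then obtain x y where xy: "e = (x, y)" "x \<in> pverts H" "y \<in> pverts H" using H by auto
    then show "e \<in> map_prod f f ` parcs G"
      using e arcs[of x y] fh by (intro image_eqI[of _ _ "(h x, h y)"]) auto
  qed
  \<comment> \<open>Arcs are pairs of end points on both sides, so \<open>f\<close> determines the
    arc map, and tail and head remain the projections.\<close>
  let ?hom = "\<lparr>iso_verts = f, iso_arcs = map_prod f f, iso_head = snd, iso_tail = fst\<rparr>"
  have "inj_on (map_prod f f) (parcs G)"
    using f G by (intro inj_on_subset[OF map_prod_inj_on]) (auto simp: bij_betw_def)
  then have "digraph_isomorphism ?hom"
    using f wf_digraph_axioms by (auto simp: digraph_isomorphism_def bij_betw_def)
  moreover have "with_proj H = app_iso ?hom (with_proj G)"
    using f img by (simp add: app_iso_def with_proj_def bij_betw_def)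
  ultimately show ?thesis
    unfolding digraph_iso_def by blast
qed

text \<open>
  The isomorphism is the inverse of the coordinate map of the family \<open>c\<close>: connectivity makes
  that map surjective, and then the cardinality hypothesis makes it bijective.
\<close>

lemma cayley_graph_iso_hamming:
  fixes K :: "'v::{field,finite} set" and c :: "nat \<Rightarrow> 'v"
  assumes graph: "pair_graph (cayley_graph S)"
    and conn: "connected (with_proj (cayley_graph S))"
    and zero: "0 \<in> K" and diff: "\<And>x y. x \<in> K \<Longrightarrow> y \<in> K \<Longrightarrow> x - y \<in> K"
    and S: "S = {x * c i | x i. x \<in> K - {0} \<and> i < b}"
    and card: "CARD('v) = card K ^ b"
  shows "digraph_iso (with_proj (cayley_graph S)) (with_proj (hamming_graph (card K) b))"
proof -
  let ?V = "hamming_verts (card K) b"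
  have add: "x + y \<in> K" if "x \<in> K" "y \<in> K" for x y
    using diff[of x "0 - y"] diff[of 0 y] zero that by simp
  \<comment> \<open>Hamming entries are numbers below \<open>card K\<close>; an arbitrary
    enumeration \<open>g\<close> decodes them as elements of \<open>K\<close>.\<close>
  obtain g where "bij_betw g {0..<card K} K"
    using ex_bij_betw_nat_finite[of K] by auto
  then have g: "bij_betw g {..<card K} K"
    by (simp add: atLeast0LessThan)
  have gK: "g i \<in> K" if "i < card K" for i
    using g that by (auto simp: bij_betw_def)
  have g_surj: "\<exists>i<card K. g i = x" if "x \<in> K" for x
    using g that by (metis bij_betw_iff_bijections lessThan_iff)
  have g_eq: "g i = g j \<longleftrightarrow> i = j" if "i < card K" "j < card K" for i j
    using g that by (auto simp: bij_betw_def dest: inj_onD)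
  define h where "h xs = (\<Sum>i<b. g (xs ! i) * c i)" for xs
  have nth: "xs ! i < card K" if "xs \<in> ?V" "i < b" for xs i
    using that nth_mem[of i xs] by (auto simp: hamming_verts_def simp del: nth_mem)
  have upd: "xs[i := x] \<in> ?V" if "xs \<in> ?V" "x < card K" for xs i x
    using that set_update_subset_insert[of xs i x] by (auto simp: hamming_verts_def)
  have h_upd: "h (xs[i := x]) = h xs + (g x - g (xs ! i)) * c i" if "xs \<in> ?V" "i < b" for xs i x
  proof -
    have "h (xs[i := x]) - h xs = (\<Sum>j<b. (g (xs[i := x] ! j) - g (xs ! j)) * c j)"
      by (simp add: h_def algebra_simps sum_subtractf)
    also have "\<dots> = (\<Sum>j<b. if j = i then (g x - g (xs ! i)) * c i else 0)"
      using that by (intro sum.cong) (auto simp: hamming_verts_def)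
    also have "\<dots> = (g x - g (xs ! i)) * c i"
      using that by simp
    finally show ?thesis by (simp add: algebra_simps)
  qed
  \<comment> \<open>Adding \<open>y * c i\<close> is realised by changing only entry
    \<open>i\<close>, to the code of \<open>g (xs ! i) + y\<close>; the entry really changes because
    \<open>y\<close> is nonzero.\<close>
  have step: "\<exists>x<card K. x \<noteq> xs ! i \<and> h (xs[i := x]) = h xs + y * c i"
    if xs: "xs \<in> ?V" "i < b" "y \<in> K - {0}" for xs i y
  proof -
    obtain x where x: "x < card K" "g x = g (xs ! i) + y"
      using g_surj[OF add[OF gK[OF nth[OF xs(1,2)]], of y]] xs(3) by auto
    then show ?thesis
      using h_upd[OF xs(1,2), of x] xs(3) by (intro exI[of _ x]) auto
  qed
  \<comment> \<open>Connectedness is phrased with the symmetric closure of the arcs, so walks may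
    also traverse an arc backwards.\<close>
  have S_minus: "- s \<in> S" if sS: "s \<in> S" for s
  proof -
    obtain x i where s: "s = x * c i" "x \<in> K - {0}" "i < b"
      using sS unfolding S by blast
    have "- s = (0 - x) * c i" "0 - x \<in> K - {0}"
      using s diff[OF zero, of x] by auto
    then show ?thesis using s(3) unfolding S by blast
  qed
  have closed: "u + s \<in> h ` ?V" if us: "u \<in> h ` ?V" "s \<in> S" for u s
  proof -
    obtain xs where xs: "u = h xs" "xs \<in> ?V" using us(1) by blast
    obtain y i where s: "s = y * c i" "y \<in> K - {0}" "i < b"
      using us(2) unfolding S by blast
    show ?thesis
      using step[OF xs(2) s(3,2)] upd[OF xs(2)] s(1) xs(1) by (metis imageI)
  qed
  \<comment> \<open>The image contains 0 and is closed under adding elements of \<open>S\<close>;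
    induction along a walk from 0 to \<open>v\<close> puts \<open>v\<close> into it.\<close>
  have surj: "h ` ?V = UNIV"
  proof -
    obtain z where z: "z < card K" "g z = 0" using g_surj[OF zero] by blast
    have "h (replicate b z) = 0"
      using z by (simp add: h_def)
    moreover have "replicate b z \<in> ?V"
      using z by (auto simp: hamming_verts_def)
    ultimately have 0: "0 \<in> h ` ?V" by (metis imageI)
    have "v \<in> h ` ?V" for v
    proof -
      have "(0, v) \<in> rtrancl_on UNIV (symcl (parcs (cayley_graph S)))"
        using conn unfolding connected_conv by (simp add: cayley_graph_def)
      then show ?thesis
      proof (induction rule: rtrancl_on_induct)
        case (step u v)
        then have "v - u \<in> S"
          using S_minus[of "u - v"] by (auto simp: symcl_def cayley_graph_def)
        then show ?case
          using closed[OF step.IH, of "v - u"] by simp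
      qed (rule 0)
    qed
    then show ?thesis by auto
  qed
  have fin: "finite ?V" and card_V: "card ?V = card K ^ b"
    using finite_lists_length_eq[of "{..<card K}" b] card_lists_length_eq[of "{..<card K}" b]
    by (simp_all add: hamming_verts_def conj_commute)
  \<comment> \<open>A surjection between finite sets of equal size is injective: the spanning family
    \<open>c\<close> gives unique coordinates.\<close>
  have inj: "inj_on h ?V"
    using surj card card_V fin by (intro eq_card_imp_inj_on) auto
  have arcs: "(xs, ys) \<in> parcs (hamming_graph (card K) b) \<longleftrightarrow> h ys - h xs \<in> S"
    if xs: "xs \<in> ?V" and ys: "ys \<in> ?V" for xs ys
  proof
    assume "(xs, ys) \<in> parcs (hamming_graph (card K) b)"
    then obtain i x where i: "i < b" "x < card K" "x \<noteq> xs ! i" "ys = xs[i := x]"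
      using hamming_adjacent_iff[OF xs] by blast
    have "h ys - h xs = (g x - g (xs ! i)) * c i"
      using h_upd[OF xs i(1)] i(4) by simp
    moreover have "g x - g (xs ! i) \<in> K - {0}"
      using diff gK nth[OF xs i(1)] i g_eq by auto
    ultimately show "h ys - h xs \<in> S" unfolding S using i(1) by blast
  next
    assume "h ys - h xs \<in> S"
    then obtain y i where s: "h ys - h xs = y * c i" "y \<in> K - {0}" "i < b"
      unfolding S by blast
    \<comment> \<open>A Hamming neighbour of \<open>xs\<close> is built with the same image as
      \<open>ys\<close>; injectivity of \<open>h\<close> then identifies the two.\<close>
    obtain x where x: "x < card K" "x \<noteq> xs ! i" "h (xs[i := x]) = h xs + y * c i"
      using step[OF xs s(3,2)] by blast
    then have "h ys = h (xs[i := x])"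
      using s(1) by (simp add: algebra_simps)
    then have "ys = xs[i := x]"
      using inj ys upd[OF xs x(1)] by (auto dest: inj_onD)
    then show "(xs, ys) \<in> parcs (hamming_graph (card K) b)"
      using hamming_adjacent_iff[OF xs] x s(3) by blast
  qed
  show ?thesis
    using graph inj surj arcs
    by (intro digraph_iso_with_projI[where h = h])
       (auto simp: bij_betw_def hamming_graph_def cayley_graph_def)
qed

section \<open>Coset decomposition of the connection set, and the equivalence\<close>

text \<open>Division of \<open>j\<close> by \<open>b\<close> with remainder splits
  \<open>\<omega> ^ (j * k)\<close> into a power of \<open>\<omega> ^ (k * b)\<close> and the coset
  representative \<open>\<omega> ^ (i * k)\<close> with \<open>i = j mod b\<close>. These
  representatives become the basis over the subfield.\<close>

lemma power_subgroup_eq_cosets: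
  fixes \<omega> :: "'v::field"
  assumes "b > 0"
  shows "{\<omega> ^ (j * k) | j. True} =
    {x * \<omega> ^ (i * k) | x i. x \<in> {\<omega> ^ (j * (k * b)) | j. True} \<and> i < b}"
proof (intro equalityI subsetI)
  fix s assume "s \<in> {\<omega> ^ (j * k) | j. True}"
  then obtain j where "s = \<omega> ^ (j * k)" by blast
  moreover have "j * k = j div b * (k * b) + j mod b * k"
    by (metis add_mult_distrib div_mult_mod_eq mult.assoc mult.commute)
  ultimately have "s = \<omega> ^ (j div b * (k * b)) * \<omega> ^ (j mod b * k)"
    by (simp add: power_add)
  then show "s \<in> {x * \<omega> ^ (i * k) | x i. x \<in> {\<omega> ^ (j * (k * b)) | j. True} \<and> i < b}"
    using assms mod_less_divisor by blast
next
  fix s assume "s \<in> {x * \<omega> ^ (i * k) | x i. x \<in> {\<omega> ^ (j * (k * b)) | j. True} \<and> i < b}"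
  then obtain j i where "s = \<omega> ^ (j * (k * b)) * \<omega> ^ (i * k)" by blast
  then have "s = \<omega> ^ ((j * b + i) * k)"
    by (simp add: algebra_simps flip: power_add)
  then show "s \<in> {\<omega> ^ (j * k) | j. True}" by blast
qed

theorem theorem3p5:
  fixes p R k a :: nat and \<omega> :: "'v::{field,finite}"
  assumes "prime p" and "R \<ge> 1"
    and "CARD('v) = p ^ R"
    and "primitive_element \<omega>"
    and "k \<ge> 2" and "k dvd p ^ R - 1"
    and "odd p \<longrightarrow> even ((p ^ R - 1) div k)"
    and "connected (with_proj (gpaley \<omega> k))"
    and "a dvd R" and "1 \<le> a" and "a < R"
  shows "digraph_iso (with_proj (gpaley \<omega> k)) (with_proj (hamming_graph (p ^ a) (R div a)))
    \<longleftrightarrow> real k = real a * (real p ^ R - 1) / (real R * (real p ^ a - 1))"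
proof -
  let ?S = "{\<omega> ^ (j * k) | j. True}"
  define b where "b = R div a"
  have R: "R = a * b"
    using assms(9) by (simp add: b_def)
  have b: "b > 0" using R assms(2) by (cases b) auto
  have p: "p > 1" using assms(1) by (rule prime_gt_1_nat)
  have pa: "p ^ a > 1" and pR: "p ^ R > 1"
    using p assms(2,10) by (auto intro!: one_less_power simp del: One_nat_def)
  have pa': "real p ^ a - 1 > 0"
    using pa by (metis diff_gt_0_iff_gt of_nat_1 of_nat_less_iff of_nat_power)
  \<comment> \<open>Substituting \<open>R = a * b\<close> cancels \<open>a\<close>; since
    \<open>p ^ a\<close> and \<open>p ^ R\<close> exceed 1, the result is an equation of natural
    numbers without truncated subtraction.\<close>
  have "real k = real a * (real p ^ R - 1) / (real R * (real p ^ a - 1)) \<longleftrightarrow>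
      real k * (real b * (real (p ^ a) - 1)) = real (p ^ R) - 1"
    using pa' assms(10) b unfolding R of_nat_power of_nat_mult
    by (simp add: mult.assoc eq_divide_eq mult.left_commute[of _ "real a"])
  also have "\<dots> \<longleftrightarrow> real (k * (b * (p ^ a - 1))) = real (p ^ R - 1)"
    using pa pR by (simp add: of_nat_diff)
  finally have arith: "real k = real a * (real p ^ R - 1) / (real R * (real p ^ a - 1)) \<longleftrightarrow>
      k * (b * (p ^ a - 1)) = p ^ R - 1"
    by (simp only: of_nat_eq_iff)
  have graph: "pair_graph (gpaley \<omega> k)"
    using pair_graph_gpaley assms(1-4,6,7) by blast
  show ?thesis unfolding arith b_def[symmetric]
  proof
    assume "digraph_iso (with_proj (gpaley \<omega> k)) (with_proj (hamming_graph (p ^ a) b))"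
    then obtain f where f: "pre_digraph.digraph_isomorphism (with_proj (gpaley \<omega> k)) f"
        "with_proj (hamming_graph (p ^ a) b) = app_iso f (with_proj (gpaley \<omega> k))"
      unfolding digraph_iso_def by blast
    interpret pair_graph "gpaley \<omega> k" by (rule graph)
    have u: "0 \<in> pverts (gpaley \<omega> k)"
      by (simp add: gpaley_def cayley_graph_def)
    then have "iso_verts f 0 \<in> verts (app_iso f (with_proj (gpaley \<omega> k)))"
      by simp
    then have "iso_verts f 0 \<in> hamming_verts (p ^ a) b"
      by (simp add: f(2)[symmetric] hamming_graph_def)
    \<comment> \<open>Out-degrees are compared at the vertex 0 and its image.\<close>
    then have "b * (p ^ a - 1) = card ?S"
      using out_degree_app_iso_eq[OF f(1) u] unfolding f(2)[symmetric]
      by (simp add: out_degree_hamming_graph gpaley_def out_degree_cayley_graph)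
    also have "\<dots> = (p ^ R - 1) div k"
      using bij_betw_same_card[OF bij_betw_power_subgroup[OF assms(4), of "(p ^ R - 1) div k" k]]
        assms(3,5,6) pR by (simp add: div_greater_zero_iff dvd_imp_le)
    finally show "k * (b * (p ^ a - 1)) = p ^ R - 1"
      using assms(6) by simp
  next
    assume eq: "k * (b * (p ^ a - 1)) = p ^ R - 1"
    let ?K = "{x::'v. x ^ p ^ a = x}"
    \<comment> \<open>Thus \<open>k * b\<close> is the index of the subgroup of order
      \<open>p ^ a - 1\<close>, and \<open>\<omega> ^ (k * b)\<close> generates that
      subgroup.\<close>
    have d: "(p ^ a - 1) * (k * b) = CARD('v) - 1"
      using eq assms(3) by (simp add: algebra_simps)
    have card: "card ?K = p ^ a"
      by (rule card_frobenius_fixed[OF assms(4) d pa])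
    have "?K - {0} = {\<omega> ^ (j * (k * b)) | j. True}"
      using frobenius_fixed_eq[OF assms(4) d pa] primitive_element_nonzero[OF assms(4)] by auto
    then have "?S = {x * \<omega> ^ (i * k) | x i. x \<in> ?K - {0} \<and> i < b}"
      using power_subgroup_eq_cosets[OF b, of \<omega> k] by simp
    moreover have "x - y \<in> ?K" if "x \<in> ?K" "y \<in> ?K" for x y
      using that frobenius_fixed_diff[OF assms(1) CHAR_eq_prime_of_CARD[OF assms(1,3)]] by simp
    moreover have "CARD('v) = card ?K ^ b"
      unfolding card assms(3) R by (simp add: power_mult)
    ultimately show "digraph_iso (with_proj (gpaley \<omega> k)) (with_proj (hamming_graph (p ^ a) b))"
      using cayley_graph_iso_hamming[of ?S ?K "\<lambda>i. \<omega> ^ (i * k)" b] graph assms(8) card p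
      unfolding gpaley_def by simp
  qed
qed

end
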